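(* Let $(\mathcal{A},\cdot)$ be a center-symmetric algebra and $V$ a vector space over $\mathbb{K}$. Let $l,r:\mathcal{A}\to\mathfrak{gl}(V)$ be two linear maps. Then $(l,r,V)$ is a bimodule of $\mathcal{A}$ if and only if the vector space $\mathcal{A}\oplus V$ is a center-symmetric algebra under the multiplication $$(x_1+v_1)\ast(x_2+v_2)=x_1\cdot x_2+(l_{x_1}v_2+r_{x_2}v_1),\qquad x_1,x_2\in\mathcal{A},\ v_1,v_2\in V.$$
   Context: Throughout, $\mathcal{A}$ is a finite-dimensional vector space over a field $\mathbb{K}$ of characteristic zero. A vector space with a bilinear product (written as juxtaposition or $\cdot$) is a center-symmetric algebra if its associator $(x,y,z):=(xy)z-x(yz)$ satisfies $(x,y,z)=(z,y,x)$ for all elements $x,y,z$. For a center-symmetric algebra $\mathcal{A}$, a vector space $V$ and linear maps $l,r:\mathcal{A}\to\mathfrak{gl}(V)$, $x\mapsto l_x$, $x\mapsto r_x$, the triple $(l,r,V)$ is called a bimodule of $\mathcal{A}$ if for all $x,y\in\mathcal{A}$: $[l_x,r_y]=[l_y,r_x]$ and $l_{xy}-l_xl_y=r_xr_y-r_{yx}$ (where the bracket is the commutator of operators). *)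

theory Defs
  imports "HOL-Analysis.Product_Vector" "HOL-Library.Function_Algebras"
begin

text \<open>
  Vector spaces over an arbitrary field are given by their scalar multiplication, via the
  library locale \<^locale>\<open>vector_space\<close>. No dimension restriction is built into the
  definitions below.
\<close>

definition associator :: "('a \<Rightarrow> 'a \<Rightarrow> 'a) \<Rightarrow> 'a \<Rightarrow> 'a \<Rightarrow> 'a \<Rightarrow> 'a::ab_group_add" where
  "associator mult x y z = mult (mult x y) z - mult x (mult y z)"

locale center_symmetric_algebra = vector_space scale
  for scale :: "'k::field \<Rightarrow> 'a::ab_group_add \<Rightarrow> 'a" +
  fixes mult :: "'a \<Rightarrow> 'a \<Rightarrow> 'a"
  assumes linear_mult_left: "Vector_Spaces.linear scale scale (\<lambda>x. mult x y)"
    and linear_mult_right: "Vector_Spaces.linear scale scale (\<lambda>y. mult x y)"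
    and center_symmetric: "associator mult x y z = associator mult z y x"

text \<open>
  Linear maps into \<open>gl(V)\<close>, the space of all linear endomorphisms of \<open>V\<close>. It is a subspace of
  the space of all functions on \<open>V\<close> with the pointwise operations, so linearity is expressed
  with respect to the latter.
\<close>

definition scale_fun :: "('k \<Rightarrow> 'v \<Rightarrow> 'v) \<Rightarrow> 'k \<Rightarrow> ('v \<Rightarrow> 'v) \<Rightarrow> 'v \<Rightarrow> 'v" where
  "scale_fun scaleV c f = (\<lambda>v. scaleV c (f v))"

definition linear_to_gl ::
  "('k::field \<Rightarrow> 'a::ab_group_add \<Rightarrow> 'a) \<Rightarrow> ('k \<Rightarrow> 'v::ab_group_add \<Rightarrow> 'v) \<Rightarrow> ('a \<Rightarrow> 'v \<Rightarrow> 'v) \<Rightarrow> bool"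
  where
  "linear_to_gl scaleA scaleV l \<longleftrightarrow>
     (\<forall>x. Vector_Spaces.linear scaleV scaleV (l x)) \<and>
     Vector_Spaces.linear scaleA (scale_fun scaleV) l"

text \<open>
  The difference of operators is pointwise, while their product is composition \<open>\<circ>\<close>, not
  the pointwise \<open>*\<close> that \<^theory>\<open>HOL-Library.Function_Algebras\<close> puts on functions.
\<close>

definition op_commutator :: "('v \<Rightarrow> 'v) \<Rightarrow> ('v \<Rightarrow> 'v) \<Rightarrow> 'v \<Rightarrow> 'v::ab_group_add" where
  "op_commutator f g = (f \<circ> g) - (g \<circ> f)"

locale center_symmetric_bimodule =
  A: center_symmetric_algebra scaleA mult + V: vector_space scaleV
  for scaleA :: "'k::field \<Rightarrow> 'a::ab_group_add \<Rightarrow> 'a"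
    and mult :: "'a \<Rightarrow> 'a \<Rightarrow> 'a"
    and scaleV :: "'k \<Rightarrow> 'v::ab_group_add \<Rightarrow> 'v" +
  fixes l r :: "'a \<Rightarrow> 'v \<Rightarrow> 'v"
  assumes linear_l: "linear_to_gl scaleA scaleV l"
    and linear_r: "linear_to_gl scaleA scaleV r"
    and commutator_eq: "op_commutator (l x) (r y) = op_commutator (l y) (r x)"
    and mult_eq: "l (mult x y) - (l x \<circ> l y) = (r x \<circ> r y) - r (mult y x)"

text \<open>The direct sum is the product type; \<open>x + v\<close> is the pair \<open>(x, v)\<close>.\<close>

fun sum_mult ::
  "('a \<Rightarrow> 'a \<Rightarrow> 'a) \<Rightarrow> ('a \<Rightarrow> 'v \<Rightarrow> 'v) \<Rightarrow> ('a \<Rightarrow> 'v \<Rightarrow> 'v) \<Rightarrow> 'a \<times> 'v \<Rightarrow> 'a \<times> 'v \<Rightarrow> 'a \<times> 'v::ab_group_add"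
  where
  "sum_mult mult l r (x1, v1) (x2, v2) = (mult x1 x2, l x1 v2 + r x2 v1)"

end

theory Submission
  imports Defs
begin

text \<open>Addition and scaling in the space of operators are pointwise, so the condition on
  \<open>l\<close> amounts to bilinearity of \<open>l x v\<close> in \<open>x\<close> and
  \<open>v\<close>, the form used in the expansions below.\<close>

lemma linear_to_glD:
  assumes "linear_to_gl scaleA scaleV l"
  shows "l x (u + v) = l x u + l x v"
    and "l x (scaleV c v) = scaleV c (l x v)"
    and "l (x + y) v = l x v + l y v"
    and "l (scaleA c x) v = scaleV c (l x v)"
proof -
  interpret lx: Vector_Spaces.linear scaleV scaleV "l x"
    using assms by (simp add: linear_to_gl_def)
  interpret l: Vector_Spaces.linear scaleA "scale_fun scaleV" l
    using assms by (simp add: linear_to_gl_def)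
  show "l x (u + v) = l x u + l x v" "l x (scaleV c v) = scaleV c (l x v)"
    by (rule lx.add, rule lx.scale)
  show "l (x + y) v = l x v + l y v" "l (scaleA c x) v = scaleV c (l x v)"
    by (simp_all add: l.add l.scale scale_fun_def)
qed

text \<open>Additivity of the operators lets both bracketings be expanded and grouped by
  \<open>u\<close>, \<open>v\<close> and \<open>w\<close>. The resulting coefficients are exactly
  the operators in the bimodule identities.\<close>

lemma associator_sum_mult:
  fixes l r :: "'a::ab_group_add \<Rightarrow> 'v::ab_group_add \<Rightarrow> 'v"
  assumes "\<And>x u v. l x (u + v) = l x u + l x v"
    and "\<And>x u v. r x (u + v) = r x u + r x v"
  shows "associator (sum_mult mult l r) (x, u) (y, v) (z, w) =
    (associator mult x y z,
     (l (mult x y) - (l x \<circ> l y)) w - op_commutator (l x) (r z) v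
       + ((r z \<circ> r y) - r (mult y z)) u)"
  by (simp add: associator_def op_commutator_def assms algebra_simps)

text \<open>These algebra axioms on the direct sum follow from linearity of \<open>l\<close> and
  \<open>r\<close> alone, so the equivalence reduces to a statement about associators.\<close>

lemma bilinear_sum_mult:
  fixes scaleA :: "'k::field \<Rightarrow> 'a::ab_group_add \<Rightarrow> 'a"
    and scaleV :: "'k \<Rightarrow> 'v::ab_group_add \<Rightarrow> 'v"
  assumes "center_symmetric_algebra scaleA mult"
    and "vector_space scaleV"
    and "linear_to_gl scaleA scaleV l"
    and "linear_to_gl scaleA scaleV r"
  defines "s \<equiv> module_prod.scale scaleA scaleV"
  shows "vector_space s"
    and "Vector_Spaces.linear s s (\<lambda>p. sum_mult mult l r p q)"
    and "Vector_Spaces.linear s s (\<lambda>q. sum_mult mult l r p q)"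
proof -
  interpret A: center_symmetric_algebra scaleA mult by fact
  interpret V: vector_space scaleV by fact
  interpret AV: vector_space_prod scaleA scaleV ..
  show "vector_space s"
    unfolding s_def by (rule AV.p.vector_space_axioms)
  interpret ml: Vector_Spaces.linear scaleA scaleA "\<lambda>x. mult x y" for y
    by (rule A.linear_mult_left)
  interpret mr: Vector_Spaces.linear scaleA scaleA "mult x" for x
    by (rule A.linear_mult_right)
  note simps = Vector_Spaces.linear_iff AV.p.vector_space_axioms AV.scale_def ml.add ml.scale mr.add mr.scale V.scale_right_distrib
    linear_to_glD[OF assms(3)] linear_to_glD[OF assms(4)]
  show "Vector_Spaces.linear s s (\<lambda>p. sum_mult mult l r p q)"
    unfolding s_def by (cases q) (simp add: simps split_paired_all)
  show "Vector_Spaces.linear s s (\<lambda>q. sum_mult mult l r p q)"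
    unfolding s_def by (cases p) (simp add: simps split_paired_all)
qed

text \<open>
  The \<open>V\<close>-component of the associator of \<open>(x, u)\<close>, \<open>(y, v)\<close>, \<open>(z, w)\<close> is a sum of three terms,
  each depending on just one of \<open>u\<close>, \<open>v\<close>, \<open>w\<close>; setting two of them to \<open>0\<close> isolates each
  bimodule identity.
\<close>

theorem proposition3p2:
  fixes scaleA :: "'k::field_char_0 \<Rightarrow> 'a::ab_group_add \<Rightarrow> 'a"
    and BasisA :: "'a set"
    and mult :: "'a \<Rightarrow> 'a \<Rightarrow> 'a"
    and scaleV :: "'k \<Rightarrow> 'v::ab_group_add \<Rightarrow> 'v"
    and l r :: "'a \<Rightarrow> 'v \<Rightarrow> 'v"
  assumes "finite_dimensional_vector_space scaleA BasisA"
    and "center_symmetric_algebra scaleA mult"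
    and "vector_space scaleV"
    and "linear_to_gl scaleA scaleV l"
    and "linear_to_gl scaleA scaleV r"
  shows "center_symmetric_bimodule scaleA mult scaleV l r \<longleftrightarrow>
         center_symmetric_algebra (module_prod.scale scaleA scaleV) (sum_mult mult l r)"
proof
  note l = linear_to_glD[OF assms(4)] and r = linear_to_glD[OF assms(5)]
  note assoc = associator_sum_mult[of l r mult, OF l(1) r(1)]
  {
    assume "center_symmetric_bimodule scaleA mult scaleV l r"
    then interpret center_symmetric_bimodule scaleA mult scaleV l r .
    have "associator (sum_mult mult l r) (x, u) (y, v) (z, w) =
          associator (sum_mult mult l r) (z, w) (y, v) (x, u)" for x y z u v w
      \<comment> \<open>By \<open>mult_eq\<close>, the \<open>l\<close>-coefficient of
        \<open>w\<close> equals its \<open>r\<close>-coefficient in the reversed associator, and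
        likewise for \<open>u\<close>. The two symmetric equations are instantiated so that they
        rewrite in one direction only.\<close>
      unfolding assoc A.center_symmetric[of x y z] commutator_eq[of x z] mult_eq
      by (simp add: mult_eq[symmetric])
    then show "center_symmetric_algebra (module_prod.scale scaleA scaleV) (sum_mult mult l r)"
      using bilinear_sum_mult[OF assms(2-5)]
      by (auto simp: center_symmetric_algebra_def center_symmetric_algebra_axioms_def)
  next
    assume "center_symmetric_algebra (module_prod.scale scaleA scaleV) (sum_mult mult l r)"
    then interpret S: center_symmetric_algebra "module_prod.scale scaleA scaleV" "sum_mult mult l r" .
    have zero: "l x 0 = 0" "r x 0 = 0" for x
      using l(1)[of x 0 0] r(1)[of x 0 0] by simp_all
    have cs: "(l (mult x y) - (l x \<circ> l y)) w - op_commutator (l x) (r z) v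
        + ((r z \<circ> r y) - r (mult y z)) u =
      (l (mult z y) - (l z \<circ> l y)) u - op_commutator (l z) (r x) v
        + ((r x \<circ> r y) - r (mult y x)) w" for x y z u v w
      using S.center_symmetric[of "(x, u)" "(y, v)" "(z, w)"] unfolding assoc by simp
    have "op_commutator (l x) (r y) = op_commutator (l y) (r x)" for x y
    proof
      show "op_commutator (l x) (r y) v = op_commutator (l y) (r x) v" for v
        \<comment> \<open>The arguments follow the order of occurrence in \<open>cs\<close>:
          \<open>x y w z v u\<close>. Only \<open>v\<close> survives, and its coefficient does not
          involve the middle algebra element, which may thus be arbitrary.\<close>
        using cs[of x _ 0 y v 0] by (simp add: zero)
    qed
    moreover have "l (mult x y) - (l x \<circ> l y) = (r x \<circ> r y) - r (mult y x)" for x y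
    proof
      show "(l (mult x y) - (l x \<circ> l y)) w = ((r x \<circ> r y) - r (mult y x)) w" for w
        \<comment> \<open>Only \<open>w\<close> survives. Its coefficients on the two sides are the
          \<open>l\<close>-side and the \<open>r\<close>-side of the identity, and neither involves
          \<open>z\<close>.\<close>
        using cs[of x y w _ 0 0] by (simp add: zero op_commutator_def)
    qed
    ultimately show "center_symmetric_bimodule scaleA mult scaleV l r"
      using assms(2-5)
      by (simp add: center_symmetric_bimodule_def center_symmetric_bimodule_axioms_def)
  }
qed

end
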